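(* Let $\Sigma^2=(\Sigma^2_0,\Sigma^2_1,\Sigma^2_2)$ be a simply connected quadrilateral cell complex. Any discrete flat front $(X,N):\Sigma^2_0\to H^3\times S^{2,1}$, defined as a discrete linear Weingarten net with mixed area Gauss curvature $K\equiv1$, admits a Weierstrass-type representation. That is, there exist a discrete holomorphic function $g:\Sigma^2_0\to\mathbb{C}$ with edge-labelling $a:\Sigma^2_1\to\mathbb{R}$, a real number $t\in\mathbb{R}\setminus\{0,\frac{1}{a_{ij}}\mid(ij)\in\Sigma^2_1\}$, a map $F:\Sigma^2_0\to\mathrm{Sl}(2,\mathbb{C})$ satisfying, for every edge $(ij)\in\Sigma^2_1$, $$F_j=F_iW_{ij}\quad\text{with}\quad W_{ij}:=\frac{1}{\sqrt{1-ta_{ij}}}\begin{pmatrix}1 & dg_{ij}\\ \frac{ta_{ij}}{dg_{ij}} & 1\end{pmatrix},$$ and a constant $s\in\mathbb{R}$ such that $$X=F\,(E_0\cosh s+E_3\sinh s)\,F^\ast\quad\text{and}\quad N=F\,(E_0\sinh s+E_3\cosh s)\,F^\ast.$$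
   Context: A quadrilateral cell complex $\Sigma^2=(\Sigma^2_0,\Sigma^2_1,\Sigma^2_2)$ consists of vertices $i\in\Sigma^2_0$, oriented edges $(ij)\in\Sigma^2_1$ from $i$ to $j$ (with $(ji)$ the reversed edge), and oriented quadrilateral faces $(ijkl)\in\Sigma^2_2$ with edges $(ij),(jk),(kl),(li)\in\Sigma^2_1$. It is simply connected if any two vertices can be joined by an edge path and every closed edge path is null-homotopic via face-flips (replacing part of the boundary of a face by the complementary part) and via dropping single-edge return trips. For a function $g$ on vertices, $dg_{ij}:=g_j-g_i$, and on a face $(ijkl)$, $\delta g_{ik}:=g_k-g_i$, $\delta g_{jl}:=g_l-g_j$. An edge-labelling is a function $a:\Sigma^2_1\to\mathbb{R}$ with $a_{ij}=a_{ji}$ for every edge and $a_{ij}=a_{kl}$ for every face $(ijkl)$. A function $g:\Sigma^2_0\to\mathbb{C}$ is discrete holomorphic with edge-labelling $a$ if $\frac{dg_{ij}}{dg_{jk}}\frac{dg_{kl}}{dg_{li}}=\frac{a_{ij}}{a_{jk}}$ for every face $(ijkl)$, where these cross ratios are assumed to be different from $0,1,\infty$ (regularity). The square root of a real number is the principal one ($\sqrt{x}=\mathrm{i}\sqrt{|x|}$ for $x<0$). Minkowski space $\mathbb{R}^{3,1}$ is the real vector space $\mathrm{Herm}(2)$ of Hermitian $2\times2$ matrices with the quadratic form $(Y,Y)=-\det Y$ (and $(\cdot,\cdot)$ its polarization). Then $H^3=\{Y\in\mathrm{Herm}(2)\mid\det Y=1,\ \mathrm{tr}\,Y>0\}$ is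 hyperbolic space and $S^{2,1}=\{Y\in\mathrm{Herm}(2)\mid\det Y=-1\}$. $E_0=\begin{pmatrix}1&0\\0&1\end{pmatrix}$, $E_3=\begin{pmatrix}1&0\\0&-1\end{pmatrix}$, and $F^\ast$ is the conjugate transpose. Discrete flat front in the mixed area sense (discrete linear Weingarten net with $K\equiv1$): a map $(X,N):\Sigma^2_0\to H^3\times S^{2,1}$ with $(X_i,N_i)=0$ at every vertex such that (1) (discrete Legendre map) on every edge $(ij)$ the vectors $dX_{ij}$ and $dN_{ij}$ are linearly dependent (discrete Rodrigues equation $0=dN_{ij}+k_{ij}dX_{ij}$; equivalently, adjacent contact elements share a common curvature sphere); (2) $K\equiv1$ on every face, where the (extrinsic) mixed area Gauss curvature $K$ is determined by $A(X+N,X-N)=A(X,X)-A(N,N)=A(X,X)\,(1-K)$, with the mixed area $A$ being the symmetric bilinear $\Lambda^2\mathbb{R}^{3,1}$-valued form given by its quadratic form $A(H,H)_{ijkl}=\frac12\,\delta H_{ik}\wedge\delta H_{jl}$.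
   Formalization: Added hypothesis: along each edge (ij), the light-like vectors X_i±N_i and X_j±N_j are pairwise non-orthogonal for all sign choices (normal geodesics at adjacent vertices share no ideal endpoint). Without it discrete horospheres (X−N constant) are counterexamples, since they force dg=0. *)

theory Defs
  imports "HOL-Analysis.Analysis"
begin

section \<open>Quadrilateral cell complexes\<close>

text \<open>
  An oriented edge is a pair of vertices, an oriented face \<open>(ijkl)\<close> a 4-tuple. Since \<open>(ijkl)\<close> and
  \<open>(jkli)\<close> denote the same oriented face, the set of 4-tuples is closed under cyclic shifts.
\<close>

definition quad_complex :: "'v set \<Rightarrow> ('v \<times> 'v) set \<Rightarrow> ('v \<times> 'v \<times> 'v \<times> 'v) set \<Rightarrow> bool" where
  "quad_complex V E Q \<longleftrightarrow>
     E \<subseteq> V \<times> V \<and> sym E \<and>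
     (\<forall>(i, j, k, l) \<in> Q. (i, j) \<in> E \<and> (j, k) \<in> E \<and> (k, l) \<in> E \<and> (l, i) \<in> E \<and> (j, k, l, i) \<in> Q)"

definition edge_path :: "'v set \<Rightarrow> ('v \<times> 'v) set \<Rightarrow> 'v list \<Rightarrow> bool" where
  "edge_path V E p \<longleftrightarrow>
     p \<noteq> [] \<and> set p \<subseteq> V \<and> (\<forall>n. Suc n < length p \<longrightarrow> (p ! n, p ! Suc n) \<in> E)"

text \<open>
  Dropping a single-edge return trip, and replacing one, two or three consecutive edges of the
  boundary of a face by the complementary part of the boundary. Reversed edges are covered because
  homotopy is the generated equivalence relation and faces are closed under cyclic shifts.
\<close>

inductive path_move :: "('v \<times> 'v) set \<Rightarrow> ('v \<times> 'v \<times> 'v \<times> 'v) set \<Rightarrow> 'v list \<Rightarrow> 'v list \<Rightarrow> bool"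
  for E Q where
  return_trip: "(i, j) \<in> E \<Longrightarrow> path_move E Q (xs @ [i, j, i] @ ys) (xs @ [i] @ ys)"
| flip1: "(i, j, k, l) \<in> Q \<Longrightarrow> path_move E Q (xs @ [i, j] @ ys) (xs @ [i, l, k, j] @ ys)"
| flip2: "(i, j, k, l) \<in> Q \<Longrightarrow> path_move E Q (xs @ [i, j, k] @ ys) (xs @ [i, l, k] @ ys)"
| flip3: "(i, j, k, l) \<in> Q \<Longrightarrow> path_move E Q (xs @ [i, j, k, l] @ ys) (xs @ [i, l] @ ys)"

definition path_homotopic ::
  "('v \<times> 'v) set \<Rightarrow> ('v \<times> 'v \<times> 'v \<times> 'v) set \<Rightarrow> 'v list \<Rightarrow> 'v list \<Rightarrow> bool" where
  "path_homotopic E Q = equivclp (path_move E Q)"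

definition quad_simply_connected ::
  "'v set \<Rightarrow> ('v \<times> 'v) set \<Rightarrow> ('v \<times> 'v \<times> 'v \<times> 'v) set \<Rightarrow> bool" where
  "quad_simply_connected V E Q \<longleftrightarrow>
     (\<forall>i\<in>V. \<forall>j\<in>V. \<exists>p. edge_path V E p \<and> hd p = i \<and> last p = j) \<and>
     (\<forall>p. edge_path V E p \<and> hd p = last p \<longrightarrow> path_homotopic E Q p [hd p])"

section \<open>Discrete holomorphic functions\<close>

definition edge_labelling ::
  "('v \<times> 'v) set \<Rightarrow> ('v \<times> 'v \<times> 'v \<times> 'v) set \<Rightarrow> ('v \<Rightarrow> 'v \<Rightarrow> real) \<Rightarrow> bool" where
  "edge_labelling E Q a \<longleftrightarrow>
     (\<forall>(i, j) \<in> E. a i j = a j i) \<and> (\<forall>(i, j, k, l) \<in> Q. a i j = a k l)"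

abbreviation df :: "('v \<Rightarrow> 'b::ab_group_add) \<Rightarrow> 'v \<Rightarrow> 'v \<Rightarrow> 'b" where
  "df g i j \<equiv> g j - g i"

text \<open>
  The four inequalities for the edge differences say that the cross ratio is a well defined number
  different from \<open>0\<close> and \<open>\<infinity>\<close>. They also rule out \<open>a j k = 0\<close>, where Isabelle's quotient is \<open>0\<close>.
\<close>

definition discrete_holomorphic ::
  "('v \<times> 'v) set \<Rightarrow> ('v \<times> 'v \<times> 'v \<times> 'v) set \<Rightarrow> ('v \<Rightarrow> complex) \<Rightarrow> ('v \<Rightarrow> 'v \<Rightarrow> real) \<Rightarrow> bool" where
  "discrete_holomorphic E Q g a \<longleftrightarrow>
     edge_labelling E Q a \<and>
     (\<forall>(i, j, k, l) \<in> Q.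
        df g i j \<noteq> 0 \<and> df g j k \<noteq> 0 \<and> df g k l \<noteq> 0 \<and> df g l i \<noteq> 0 \<and>
        (df g i j / df g j k) * (df g k l / df g l i) \<noteq> 1 \<and>
        (df g i j / df g j k) * (df g k l / df g l i) = of_real (a i j / a j k))"

section \<open>The Hermitian model of Minkowski space\<close>

type_synonym cmat2 = "complex^2^2"

definition mat2 :: "complex \<Rightarrow> complex \<Rightarrow> complex \<Rightarrow> complex \<Rightarrow> cmat2" where
  "mat2 p q r s = vector [vector [p, q], vector [r, s]]"

definition conj_transpose :: "cmat2 \<Rightarrow> cmat2" where
  "conj_transpose M = (\<chi> i j. cnj (M $ j $ i))"

definition Herm2 :: "cmat2 set" where
  "Herm2 = {Y. conj_transpose Y = Y}"

text \<open>On \<open>Herm2\<close> determinant and trace are real, so taking real parts loses nothing.\<close>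

definition mink_quad :: "cmat2 \<Rightarrow> real" where
  "mink_quad Y = - Re (det Y)"

definition mink :: "cmat2 \<Rightarrow> cmat2 \<Rightarrow> real" where
  "mink Y Z = (mink_quad (Y + Z) - mink_quad Y - mink_quad Z) / 2"

definition hyperbolic_space :: "cmat2 set" where
  "hyperbolic_space = {Y \<in> Herm2. det Y = 1 \<and> Re (trace Y) > 0}"

definition de_sitter_space :: "cmat2 set" where
  "de_sitter_space = {Y \<in> Herm2. det Y = - 1}"

definition E0 :: cmat2 where "E0 = mat2 1 0 0 1"
definition E3 :: cmat2 where "E3 = mat2 1 0 0 (- 1)"

section \<open>Mixed area and discrete flat fronts\<close>

text \<open>
  Elements of the second exterior power are represented as alternating bilinear forms on the dual
  space, the latter being identified with the space itself by the Euclidean inner product; thus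
  \<open>wedge\<close> is \<open>x \<otimes> y - y \<otimes> x\<close>, and addition and scaling of bivectors are pointwise.
\<close>

type_synonym bivector = "cmat2 \<Rightarrow> cmat2 \<Rightarrow> real"

definition wedge :: "cmat2 \<Rightarrow> cmat2 \<Rightarrow> bivector" where
  "wedge x y = (\<lambda>p q. (x \<bullet> p) * (y \<bullet> q) - (x \<bullet> q) * (y \<bullet> p))"

text \<open>The polarization of the quadratic form \<open>(1/2) \<delta>H\<^sub>i\<^sub>k \<and> \<delta>H\<^sub>j\<^sub>l\<close>.\<close>

fun mixed_area ::
  "('v \<Rightarrow> cmat2) \<Rightarrow> ('v \<Rightarrow> cmat2) \<Rightarrow> 'v \<times> 'v \<times> 'v \<times> 'v \<Rightarrow> bivector" where
  "mixed_area G H (i, j, k, l) =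
     (\<lambda>p q. (wedge (df G i k) (df H j l) p q + wedge (df H i k) (df G j l) p q) / 4)"

text \<open>
  The Gauss curvature of a face is determined by its defining equation only if
  \<open>A(X, X)\<close> does not vanish; otherwise the face has no Gauss curvature.
\<close>

definition has_gauss_curvature ::
  "('v \<Rightarrow> cmat2) \<Rightarrow> ('v \<Rightarrow> cmat2) \<Rightarrow> 'v \<times> 'v \<times> 'v \<times> 'v \<Rightarrow> real \<Rightarrow> bool" where
  "has_gauss_curvature X N f K \<longleftrightarrow>
     (\<exists>p q. mixed_area X X f p q \<noteq> 0) \<and>
     (\<forall>p q. mixed_area (\<lambda>i. X i + N i) (\<lambda>i. X i - N i) f p q = (1 - K) * mixed_area X X f p q)"

definition discrete_legendre ::
  "('v \<times> 'v) set \<Rightarrow> ('v \<Rightarrow> cmat2) \<Rightarrow> ('v \<Rightarrow> cmat2) \<Rightarrow> bool" where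
  "discrete_legendre E X N \<longleftrightarrow>
     (\<forall>(i, j) \<in> E. \<exists>b c :: real. (b, c) \<noteq> (0, 0) \<and> b *\<^sub>R df X i j + c *\<^sub>R df N i j = 0)"

definition discrete_flat_front ::
  "'v set \<Rightarrow> ('v \<times> 'v) set \<Rightarrow> ('v \<times> 'v \<times> 'v \<times> 'v) set \<Rightarrow>
   ('v \<Rightarrow> cmat2) \<Rightarrow> ('v \<Rightarrow> cmat2) \<Rightarrow> bool" where
  "discrete_flat_front V E Q X N \<longleftrightarrow>
     (\<forall>i\<in>V. X i \<in> hyperbolic_space \<and> N i \<in> de_sitter_space \<and> mink (X i) (N i) = 0) \<and>
     discrete_legendre E X N \<and>
     (\<forall>f\<in>Q. has_gauss_curvature X N f 1)"

text \<open>
  Regularity of a front. The light-like vectors \<open>X i + N i\<close> and \<open>X i - N i\<close> represent the ideal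
  endpoints of the normal geodesic at \<open>i\<close> (the values of the two hyperbolic Gauss maps), and
  light-like vectors are orthogonal iff they represent the same ideal point. Hence the condition
  says that normal geodesics at adjacent vertices have no ideal endpoint in common. It excludes
  horospheres (one Gauss map constant) and edges along which a normal geodesic is merely reversed;
  neither has a representation by matrices \<open>weierstrass_matrix\<close> with \<open>dg \<noteq> 0\<close> and \<open>a \<noteq> 0\<close>.
\<close>

definition regular_front ::
  "('v \<times> 'v) set \<Rightarrow> ('v \<Rightarrow> cmat2) \<Rightarrow> ('v \<Rightarrow> cmat2) \<Rightarrow> bool" where
  "regular_front E X N \<longleftrightarrow>
     (\<forall>(i, j) \<in> E.
        mink (X i + N i) (X j + N j) \<noteq> 0 \<and> mink (X i - N i) (X j - N j) \<noteq> 0 \<and>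
        mink (X i + N i) (X j - N j) \<noteq> 0 \<and> mink (X i - N i) (X j + N j) \<noteq> 0)"

section \<open>The Weierstrass-type representation\<close>

text \<open>On real arguments \<open>csqrt\<close> is the principal root, \<open>\<i> * sqrt \<bar>x\<bar>\<close> for \<open>x < 0\<close>;
  \<open>mat c\<close> is the scalar matrix \<open>c\<close> times the identity.\<close>

definition weierstrass_matrix :: "real \<Rightarrow> real \<Rightarrow> complex \<Rightarrow> cmat2" where
  "weierstrass_matrix t a dg =
     mat (1 / csqrt (of_real (1 - t * a))) ** mat2 1 dg (of_real (t * a) / dg) 1"

end

theory Submission
  imports Defs
begin

text \<open>
  The light-like vectors \<open>X + N\<close> and \<open>X - N\<close> at a vertex are \<open>2 p p\<^sup>*\<close> and \<open>2 m m\<^sup>*\<close> for spinors \<open>p\<close>, \<open>m\<close> which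
  can be scaled to \<open>det (p, m) = 1\<close> (lemma \<open>frame_exists\<close>). The matrix \<open>F = (p, m)\<close> then satisfies \<open>X = F F\<^sup>*\<close> and
  \<open>N = F E\<^sub>3 F\<^sup>*\<close>, and it is unique up to \<open>F \<mapsto> F diag(u, u\<^sup>-\<^sup>1)\<close> with a phase \<open>u\<close>. The
  representation exists with \<open>s = 0\<close> and \<open>t = 1\<close>: a different \<open>s\<close> amounts to multiplying \<open>F\<close> by
  a constant diagonal matrix, which rescales \<open>g\<close>, and \<open>t\<close> enters only through \<open>t a\<close>.

  Along an edge the curvature sphere condition forces
  \<open>F\<^sub>i\<^sup>-\<^sup>1 F\<^sub>j = (A, B; k B', A')\<close>, where the dash is complex conjugation and \<open>k\<close> is the real
  factor with \<open>d(X + N) = k d(X - N)\<close> (lemma \<open>edge_frames\<close>). So the transition is a Weierstrass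
  matrix, with \<open>dg = B / A\<close> and \<open>a = 1 - 1 / \<bar>A\<bar>\<^sup>2\<close>, as soon as \<open>A > 0\<close>.
  Two obstructions remain: the phases of the \<open>F\<^sub>i\<close> have to be chosen such that every \<open>A\<close>
  is positive, and the quotients \<open>B / A\<close> have to be the differences of a function \<open>g\<close>. By simple
  connectedness both are conditions on single faces (lemma \<open>parallel_section\<close>).

  The condition \<open>K = 1\<close> says that \<open>A(X + N, X - N) = 0\<close>: the edge-parallel quadrilaterals \<open>X + N\<close>
  and \<open>X - N\<close> are dual to each other. For the four edge factors this means \<open>k\<^sub>1 k\<^sub>3 = k\<^sub>2 k\<^sub>4\<close>, with
  adjacent factors different (lemma \<open>dual_quadrilateral\<close>). Inserted into the closing condition of
  the transitions it gives \<open>A\<^sub>i\<^sub>j A\<^sub>j\<^sub>k = A\<^sub>i\<^sub>l A\<^sub>l\<^sub>k\<close> (lemma \<open>face_holonomy\<close>), which is the closedness of the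
  phases. The same identity for the shifted face shows that \<open>\<bar>A\<bar>\<close> agrees on opposite edges (lemma
  \<open>face_moduli\<close>), hence \<open>a\<close> is an edge-labelling. The closedness of \<open>B / A\<close> and the cross ratio
  follow. A cross ratio \<open>1\<close> would make \<open>F\<close> agree at two opposite vertices, so that \<open>A(X, X) = 0\<close>.
\<close>

section \<open>Integration on simply connected complexes\<close>

fun transport :: "('v \<Rightarrow> 'v \<Rightarrow> 's \<Rightarrow> 's) \<Rightarrow> 'v list \<Rightarrow> 's \<Rightarrow> 's" where
  "transport T (i # j # xs) z = transport T (j # xs) (T i j z)"
| "transport T _ z = z"

lemma transport_split:
  "transport T (xs @ x # ys) z = transport T (x # ys) (transport T (xs @ [x]) z)"
proof (induction xs arbitrary: z)
  case (Cons y xs)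
  then show ?case by (cases xs) auto
qed simp

lemma edge_path_successively:
  "edge_path V E p \<longleftrightarrow> p \<noteq> [] \<and> set p \<subseteq> V \<and> successively (\<lambda>i j. (i, j) \<in> E) p"
  by (auto simp: edge_path_def successively_conv_nth)

lemma edge_path_concat:
  assumes "edge_path V E (xs @ [x])" "edge_path V E (x # ys)"
  shows "edge_path V E (xs @ x # ys)"
  using assms by (auto simp: edge_path_successively successively_append_iff)

lemma transport_mem:
  assumes "edge_path V E p" and "\<And>i j z. (i, j) \<in> E \<Longrightarrow> z \<in> S \<Longrightarrow> T i j z \<in> S" and "z \<in> S"
  shows "transport T p z \<in> S"
  using assms(1,3)
proof (induction p arbitrary: z)
  case (Cons i p)
  then show ?case using assms(2) by (cases p) (auto simp: edge_path_successively)
qed (simp add: edge_path_successively)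

text \<open>
  A connection without curvature. Its fibre is any type, so that the same locale
  integrates a multiplicative cocycle (the phases of the frames) and an additive one
  (the differences of the holomorphic function). The holonomy condition is stated for the two ways
  from \<open>i\<close> to \<open>k\<close> around a face; the other flips follow from it by going back along an edge.
\<close>

locale flat_transport =
  fixes V :: "'v set" and E :: "('v \<times> 'v) set" and Q :: "('v \<times> 'v \<times> 'v \<times> 'v) set"
    and T :: "'v \<Rightarrow> 'v \<Rightarrow> 's \<Rightarrow> 's"
  assumes complex: "quad_complex V E Q"
    and simply_connected: "quad_simply_connected V E Q"
    and return: "(i, j) \<in> E \<Longrightarrow> T j i (T i j z) = z"
    and face: "(i, j, k, l) \<in> Q \<Longrightarrow> T j k (T i j z) = T l k (T i l z)"
begin

lemma transport_path_move:
  assumes "path_move E Q p q"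
  shows "transport T p z = transport T q z"
proof -
  have split: "transport T (xs @ i # r) z = transport T (i # r) (transport T (xs @ [i]) z)" for xs i r
    by (rule transport_split)
  from assms show ?thesis
  proof cases
    case (return_trip i j xs ys)
    define w where "w = transport T (xs @ [i]) z"
    show ?thesis using return_trip by (simp add: split[of xs i, folded w_def] return)
  next
    case (flip1 i j k l xs ys)
    define w where "w = transport T (xs @ [i]) z"
    have "(j, k) \<in> E" using flip1(3) complex by (auto simp: quad_complex_def)
    then have "T k j (T l k (T i l w)) = T i j w"
      using return[of j k "T i j w"] face[OF flip1(3), of w] by simp
    with flip1 show ?thesis by (simp add: split[of xs i, folded w_def])
  next
    case (flip2 i j k l xs ys)
    define w where "w = transport T (xs @ [i]) z"
    show ?thesis using flip2 by (simp add: split[of xs i, folded w_def] face)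
  next
    case (flip3 i j k l xs ys)
    define w where "w = transport T (xs @ [i]) z"
    have "(l, k) \<in> E" using flip3(3) complex by (fastforce simp: quad_complex_def sym_def)
    then have "T k l (T j k (T i j w)) = T i l w"
      using return[of l k "T i l w"] face[OF flip3(3), of w] by simp
    with flip3 show ?thesis by (simp add: split[of xs i, folded w_def])
  qed
qed

lemma transport_homotopic:
  assumes "path_homotopic E Q p q"
  shows "transport T p z = transport T q z"
  using assms unfolding path_homotopic_def
proof (induction rule: equivclp_induct)
  case (step q r)
  then show ?case using transport_path_move[of q r z] transport_path_move[of r q z] by auto
qed simp

lemma transport_closed:
  assumes "edge_path V E p" "hd p = last p"
  shows "transport T p z = z"
proof -
  have "path_homotopic E Q p [hd p]"
    using assms simply_connected by (auto simp: quad_simply_connected_def)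
  from transport_homotopic[OF this] show ?thesis by simp
qed

text \<open>
  The value at \<open>i\<close> is transported from a base point along a chosen path. For an edge \<open>(i, j)\<close> the two
  candidate values at \<open>j\<close> are compared by transporting both back to the base point along one
  chosen path, which avoids reversing paths. The set \<open>S\<close> carries invariants of the fibre, such as
  having modulus one.
\<close>

lemma parallel_section:
  assumes S: "\<And>i j z. (i, j) \<in> E \<Longrightarrow> z \<in> S \<Longrightarrow> T i j z \<in> S" and z0: "z0 \<in> S"
  obtains \<phi> where "\<And>i. i \<in> V \<Longrightarrow> \<phi> i \<in> S" "\<And>i j. (i, j) \<in> E \<Longrightarrow> \<phi> j = T i j (\<phi> i)"
proof (cases "V = {}")
  case True
  then have "E = {}" using complex by (auto simp: quad_complex_def)
  with True that show ?thesis by blast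
next
  case False
  then obtain b where b: "b \<in> V" by auto
  have conn: "\<exists>p. edge_path V E p \<and> hd p = i \<and> last p = j" if "i \<in> V" "j \<in> V" for i j
    using simply_connected that by (auto simp: quad_simply_connected_def)
  have "\<forall>i. \<exists>p. i \<in> V \<longrightarrow> edge_path V E (p @ [i]) \<and> hd (p @ [i]) = b"
  proof
    fix i
    show "\<exists>p. i \<in> V \<longrightarrow> edge_path V E (p @ [i]) \<and> hd (p @ [i]) = b"
    proof (cases "i \<in> V")
      case True
      then obtain p where p: "edge_path V E p" "hd p = b" "last p = i" using conn b by blast
      then have "butlast p @ [i] = p" using append_butlast_last_id[of p] by (simp add: edge_path_def)
      with p show ?thesis by (intro exI[of _ "butlast p"]) (simp only: simp_thms)
    qed auto
  qed
  then obtain out where out: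
      "\<And>i. i \<in> V \<Longrightarrow> edge_path V E (out i @ [i])" "\<And>i. i \<in> V \<Longrightarrow> hd (out i @ [i]) = b"
    by metis
  have "\<forall>i. \<exists>p. i \<in> V \<longrightarrow> edge_path V E (i # p) \<and> last (i # p) = b"
  proof
    fix i
    show "\<exists>p. i \<in> V \<longrightarrow> edge_path V E (i # p) \<and> last (i # p) = b"
    proof (cases "i \<in> V")
      case True
      then obtain p where p: "edge_path V E p" "hd p = i" "last p = b" using conn b by blast
      then have "i # tl p = p" using hd_Cons_tl[of p] by (simp add: edge_path_def)
      with p show ?thesis by (intro exI[of _ "tl p"]) (simp only: simp_thms)
    qed auto
  qed
  then obtain home where home:
      "\<And>i. i \<in> V \<Longrightarrow> edge_path V E (i # home i)" "\<And>i. i \<in> V \<Longrightarrow> last (i # home i) = b"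
    by metis
  define \<phi> where "\<phi> i = transport T (out i @ [i]) z0" for i
  show thesis
  proof
    fix i assume "i \<in> V"
    then show "\<phi> i \<in> S"
      unfolding \<phi>_def by (intro transport_mem[OF out(1)]) (use S z0 in auto)
  next
    fix i j assume ij: "(i, j) \<in> E"
    then have V: "i \<in> V" "j \<in> V" using complex by (auto simp: quad_complex_def)
    \<comment> \<open>the loop from the base point over \<open>i\<close> and \<open>j\<close> and home\<close>
    have "edge_path V E (i # j # home j)"
      using home(1)[OF V(2)] ij V by (auto simp: edge_path_successively)
    then have "edge_path V E (out i @ i # j # home j)"
      by (rule edge_path_concat[OF out(1)[OF V(1)]])
    moreover have "hd (out i @ i # j # home j) = b"
      using out(2)[OF V(1)] by (cases "out i") auto
    ultimately have "transport T (out i @ i # j # home j) z0 = z0"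
      using home(2)[OF V(2)] by (intro transport_closed) auto
    then have 1: "transport T (j # home j) (T i j (\<phi> i)) = z0"
      by (simp add: transport_split[of T "out i" i "j # home j"] \<phi>_def)
    \<comment> \<open>the loop from \<open>j\<close> home and out to \<open>j\<close> again shows that going home is injective\<close>
    obtain h where h: "j # home j = h @ [b]"
      using home(2)[OF V(2)] append_butlast_last_id[of "j # home j"] that by (metis list.distinct(2))
    obtain r where r: "out j @ [j] = b # r"
      using out(2)[OF V(2)] hd_Cons_tl[of "out j @ [j]"] that by (metis snoc_eq_iff_butlast)
    have "edge_path V E (h @ b # r)"
      using edge_path_concat[of V E h b r] home(1)[OF V(2)] out(1)[OF V(2)] unfolding h r by blast
    moreover have "hd (h @ b # r) = j"
      using h by (cases h) auto
    moreover have "last (h @ b # r) = j"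
      using arg_cong[OF r, of last] by simp
    ultimately have "transport T (h @ b # r) w = w" for w
      by (intro transport_closed) auto
    then have "transport T (out j @ [j]) (transport T (j # home j) w) = w" for w
      unfolding h r transport_split[of T h b r, symmetric] by blast
    from this[of "T i j (\<phi> i)"] show "\<phi> j = T i j (\<phi> i)"
      using 1 by (simp add: \<phi>_def)
  qed
qed

end

section \<open>Two by two complex matrices\<close>

lemma cmat2_eq_iff:
  fixes M N :: cmat2
  shows "M = N \<longleftrightarrow> M$1$1 = N$1$1 \<and> M$1$2 = N$1$2 \<and> M$2$1 = N$2$1 \<and> M$2$2 = N$2$2"
  by (auto simp: vec_eq_iff forall_2)

lemma mat2_nth [simp]:
  "mat2 p q r s $ 1 $ 1 = p" "mat2 p q r s $ 1 $ 2 = q"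
  "mat2 p q r s $ 2 $ 1 = r" "mat2 p q r s $ 2 $ 2 = s"
  by (simp_all add: mat2_def)

lemma conj_transpose_nth [simp]: "conj_transpose M $ i $ j = cnj (M $ j $ i)"
  by (simp add: conj_transpose_def)

lemma matrix_mult_nth2:
  fixes M N :: cmat2
  shows "(M ** N) $ i $ j = M $ i $ 1 * N $ 1 $ j + M $ i $ 2 * N $ 2 $ j"
  by (simp add: matrix_matrix_mult_def sum_2)

lemma mat1_nth [simp]:
  "(mat c :: cmat2) $ 1 $ 1 = c" "(mat c :: cmat2) $ 1 $ 2 = 0"
  "(mat c :: cmat2) $ 2 $ 1 = 0" "(mat c :: cmat2) $ 2 $ 2 = c"
  by (simp_all add: mat_def)

lemma E0_eq: "E0 = mat 1"
  by (simp add: E0_def cmat2_eq_iff)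

lemmas entries = cmat2_eq_iff matrix_mult_nth2 E3_def

lemma matrix_add_rdistrib:
  fixes A B C :: cmat2
  shows "(A + B) ** C = A ** C + B ** C"
  by (simp add: entries algebra_simps)

lemma conj_transpose_mult: "conj_transpose (M ** N) = conj_transpose N ** conj_transpose M"
  by (simp add: entries algebra_simps)

definition adj2 :: "cmat2 \<Rightarrow> cmat2" where
  "adj2 M = mat2 (M$2$2) (- (M$1$2)) (- (M$2$1)) (M$1$1)"

lemma det_adj2 [simp]: "det (adj2 M) = det M"
  by (simp add: adj2_def det_2 algebra_simps)

lemma adj2_inverse:
  assumes "det M = 1"
  shows "adj2 M ** M = mat 1" "M ** adj2 M = mat 1"
  using assms by (auto simp: adj2_def entries det_2 algebra_simps)

lemma congruence_cancel:
  assumes "det M = 1" "M ** Y ** conj_transpose M = 0"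
  shows "Y = 0"
proof -
  have "Y = (adj2 M ** M) ** Y ** conj_transpose (adj2 M ** M)"
    using assms(1) by (simp add: adj2_inverse) (simp add: entries)
  also have "\<dots> = adj2 M ** (M ** Y ** conj_transpose M) ** conj_transpose (adj2 M)"
    by (simp add: conj_transpose_mult matrix_mul_assoc)
  finally show ?thesis using assms(2) by (simp add: entries)
qed

section \<open>Spinor frames\<close>

text \<open>
  A singular Hermitian matrix has rank at most one; \<open>e\<close> is the sign of its nonzero eigenvalue (if any), that
  is, the time orientation of the light-like vector.
\<close>

lemma lightlike_spinor:
  fixes Y :: cmat2
  assumes "Y \<in> Herm2" "det Y = 0"
  obtains e :: real and u v :: complex where "e\<^sup>2 = 1" "Y = mat2 (e * (u * cnj u)) (e * (u * cnj v))
     (e * (v * cnj u)) (e * (v * cnj v))"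
proof -
  have c: "cnj (Y$1$1) = Y$1$1" "cnj (Y$2$2) = Y$2$2" "Y$2$1 = cnj (Y$1$2)"
    using assms(1) by (auto simp: Herm2_def cmat2_eq_iff)
  define p q z where "p = Re (Y$1$1)" and "q = Re (Y$2$2)" and "z = Y$1$2"
  have Y: "Y$1$1 = of_real p" "Y$2$2 = of_real q" "Y$2$1 = cnj z"
    using c by (auto simp: p_def q_def z_def complex_eq_iff)
  have zz: "of_real (p * q) = z * cnj z"
    using assms(2) by (simp add: det_2 Y) (simp add: z_def Y)
  then have pq: "p * q = (cmod z)\<^sup>2"
    by (metis complex_norm_square of_real_eq_iff)
  define e where "e = (if p > 0 \<or> q > 0 then 1 else -1 :: real)"
  have pq0: "p * q \<ge> 0" by (simp add: pq)
  have ep: "e * p \<ge> 0" "e * q \<ge> 0"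
    using pq0 by (auto simp: e_def zero_le_mult_iff)
  have e2: "e * e = 1" "\<bar>e\<bar> = 1" by (auto simp: e_def)
  show thesis
  proof (cases "p = 0")
    case True
    then have "z = 0" using pq by simp
    moreover have "of_real q = e * (complex_of_real (sqrt (e * q)) * cnj (sqrt (e * q)))"
    proof -
      have "e * (sqrt (e * q) * sqrt (e * q)) = q" using ep e2 by (simp flip: mult.assoc)
      then show ?thesis by (metis complex_cnj_complex_of_real of_real_mult)
    qed
    ultimately show thesis
      using True e2 by (intro that[of e 0 "of_real (sqrt (e * q))"])
        (auto simp: cmat2_eq_iff Y z_def power2_eq_square)
  next
    case False
    define r where "r = sqrt (e * p)"
    have r: "e * (r * r) = p" "r \<noteq> 0" using False ep e2 by (auto simp: r_def simp flip: mult.assoc)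
    have r': "of_real e * (of_real r * of_real r) = complex_of_real p"
      using r(1) by (metis of_real_mult)
    have e2': "of_real e * of_real e = (1::complex)" using e2 by (metis of_real_1 of_real_mult)
    have 1: "of_real e * (of_real r * cnj (e * cnj z / of_real r)) = z"
      using r e2' by (simp add: field_simps)
    have 2: "of_real e * (e * cnj z / of_real r * cnj (of_real r)) = cnj z"
      using r e2' by (simp add: field_simps)
    have 3: "of_real e * (e * cnj z / of_real r * cnj (e * cnj z / of_real r)) = of_real q"
    proof -
      have "of_real e * (e * cnj z / of_real r * cnj (e * cnj z / of_real r))
          = (of_real e * of_real e) * (z * cnj z) * of_real e / (of_real r * of_real r)"
        by simp
      also have "\<dots> = of_real ((p * q) * e / (r * r))"
        by (simp add: e2' flip: zz)
      also have "(p * q) * e / (r * r) = q"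
      proof -
        have "p * q * e = (e * e) * (r * r) * q" by (simp flip: r(1))
        then have "p * q * e = (r * r) * q" by (simp only: e2 mult_1)
        then show ?thesis using r(2) by (simp only: nonzero_mult_div_cancel_left mult_eq_0_iff) simp
      qed
      finally show ?thesis .
    qed
    show thesis
      by (rule that[of e "of_real r" "of_real e * cnj z / of_real r"])
        (use e2 r' 1 2 3 in \<open>simp_all add: cmat2_eq_iff Y z_def power2_eq_square\<close>)
  qed
qed

definition framed :: "cmat2 \<Rightarrow> cmat2 \<Rightarrow> cmat2 \<Rightarrow> bool" where
  "framed X N F \<longleftrightarrow> det F = 1 \<and> X = F ** conj_transpose F \<and> N = F ** E3 ** conj_transpose F"

text \<open>
  Since \<open>det X = e e' \<bar>d\<bar>\<^sup>2\<close>, with \<open>d\<close> the determinant of the two spinors, \<open>det X = 1\<close> makes the two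
  light-like vectors equally time-oriented and \<open>d\<close> a phase; the positive trace makes them future pointing.
\<close>

lemma frame_exists:
  assumes X: "X \<in> hyperbolic_space" and N: "N \<in> de_sitter_space" and XN: "mink X N = 0"
  obtains F where "framed X N F"
proof -
  have herm: "X \<in> Herm2" "N \<in> Herm2" and dX: "det X = 1" and dN: "det N = -1" and tr: "Re (trace X) > 0"
    using X N by (auto simp: hyperbolic_space_def de_sitter_space_def)
  have hX: "cnj (X$1$1) = X$1$1" "cnj (X$2$2) = X$2$2" "X$2$1 = cnj (X$1$2)"
   and hN: "cnj (N$1$1) = N$1$1" "cnj (N$2$2) = N$2$2" "N$2$1 = cnj (N$1$2)"
    using herm by (auto simp: Herm2_def cmat2_eq_iff)
  define P M :: cmat2 where "P = mat (1/2) ** (X + N)" and "M = mat (1/2) ** (X - N)"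
  have "Re (det (X + N)) = 0"
    using XN dX dN by (simp add: mink_def mink_quad_def)
  moreover have "Im (X$1$1) = 0" "Im (X$2$2) = 0" "Im (N$1$1) = 0" "Im (N$2$2) = 0"
    using hX hN by (auto simp: complex_eq_iff)
  ultimately have sum0: "det (X + N) = 0"
    by (simp add: det_2 hX hN complex_eq_iff algebra_simps)
  have "det (X + N) + det (X - N) = 2 * det X + 2 * det N"
    by (simp add: det_2 algebra_simps)
  with sum0 dX dN have diff0: "det (X - N) = 0" by simp
  have hP: "P \<in> Herm2" "det P = 0" and hM: "M \<in> Herm2" "det M = 0"
    using sum0 diff0 hX hN by (simp_all add: P_def M_def Herm2_def det_mul entries)
  obtain e :: real and u v where e: "e\<^sup>2 = 1" and P: "P = mat2 (of_real e * (u * cnj u)) (of_real e * (u * cnj v))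
     (of_real e * (v * cnj u)) (of_real e * (v * cnj v))"
    using lightlike_spinor[OF hP] .
  obtain e' :: real and u' v' where e': "e'\<^sup>2 = 1" and M: "M = mat2 (of_real e' * (u' * cnj u')) (of_real e' * (u' * cnj v'))
     (of_real e' * (v' * cnj u')) (of_real e' * (v' * cnj v'))"
    using lightlike_spinor[OF hM] .
  have XPM: "X = P + M" and NPM: "N = P - M"
    by (simp_all add: P_def M_def entries field_simps)
  define d where "d = u * v' - v * u'"
  have "det X = of_real (e * e') * (d * cnj d)"
    unfolding XPM P M det_2 d_def by (simp add: algebra_simps)
  then have "of_real (e * e') * (d * cnj d) = 1" using dX by simp
  then have "of_real (e * e' * (cmod d)\<^sup>2) = complex_of_real 1"
    by (simp only: of_real_mult complex_norm_square of_real_1)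
  then have ee: "e * e' * (cmod d)\<^sup>2 = 1" by (simp only: of_real_eq_iff)
  have "e = 1 \<or> e = -1" "e' = 1 \<or> e' = -1" using e e' by (auto simp: power2_eq_1_iff)
  then have disj: "e = 1 \<or> e = -1" "e' = 1 \<or> e' = -1" by auto
  have same: "e' = e"
  proof (rule ccontr)
    assume "e' \<noteq> e"
    then have "e * e' = -1" using disj by auto
    then have "(cmod d)\<^sup>2 = -1" using ee by simp
    then show False using zero_le_power2[of "cmod d"] by linarith
  qed
  have "trace X = of_real (e * ((cmod u)\<^sup>2 + (cmod v)\<^sup>2 + (cmod u')\<^sup>2 + (cmod v')\<^sup>2))"
    unfolding XPM P M same trace_def of_real_mult of_real_add complex_norm_square
    by (simp add: sum_2 algebra_simps)
  then have "e * ((cmod u)\<^sup>2 + (cmod v)\<^sup>2 + (cmod u')\<^sup>2 + (cmod v')\<^sup>2) > 0" using tr by simp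
  moreover have "(cmod u)\<^sup>2 + (cmod v)\<^sup>2 + (cmod u')\<^sup>2 + (cmod v')\<^sup>2 \<ge> 0" by simp
  ultimately have "\<not> e \<le> 0" using mult_nonpos_nonneg leD by blast
  then have e1: "e = 1" using disj by auto
  have dd: "d * cnj d = 1" using \<open>of_real (e * e') * (d * cnj d) = 1\<close> same e1 by simp
  \<comment> \<open>multiplying the second spinor by a phase does not change its light-like vector\<close>
  define F where "F = mat2 u (u' * cnj d) v (v' * cnj d)"
  have "det F = d * cnj d" by (simp add: F_def det_2 d_def algebra_simps)
  moreover have "x * cnj d * (d * y) = x * y * (d * cnj d)" for x y
    by (simp add: ac_simps)
  then have ph: "x * cnj d * (d * y) = x * y" "x * (cnj d * (d * y)) = x * y" for x y
    using dd by (simp_all add: mult.assoc)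
  moreover have "cnj d * d = 1" using dd by (simp add: mult.commute)
  ultimately show thesis using dd
    by (intro that[of F]) (auto simp: framed_def XPM NPM P M same e1 F_def entries ph)
qed

text \<open>
  This translates the regularity of a front: two light-like vectors are orthogonal iff
  their spinors are parallel, so regularity says that no entry of a transition matrix vanishes.
\<close>

lemma mink_outer:
  "mink (mat2 (2 * (u * cnj u)) (2 * (u * cnj v)) (2 * (v * cnj u)) (2 * (v * cnj v)))
        (mat2 (2 * (x * cnj x)) (2 * (x * cnj y)) (2 * (y * cnj x)) (2 * (y * cnj y)))
   = - 2 * (cmod (u * y - v * x))\<^sup>2"
proof -
  have "(cmod (u * y - v * x))\<^sup>2 = Re ((u * y - v * x) * cnj (u * y - v * x))"
    by (metis Re_complex_of_real complex_norm_square)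
  then show ?thesis
    by (simp add: mink_def mink_quad_def det_2 algebra_simps)
qed


lemma framed_sum:
  assumes "framed X N F"
  shows "X + N = mat2 (2 * (F$1$1 * cnj (F$1$1))) (2 * (F$1$1 * cnj (F$2$1)))
                      (2 * (F$2$1 * cnj (F$1$1))) (2 * (F$2$1 * cnj (F$2$1)))"
    and "X - N = mat2 (2 * (F$1$2 * cnj (F$1$2))) (2 * (F$1$2 * cnj (F$2$2)))
                      (2 * (F$2$2 * cnj (F$1$2))) (2 * (F$2$2 * cnj (F$2$2)))"
  using assms by (simp_all add: framed_def entries)

section \<open>Transitions along edges\<close>

text \<open>
  For \<open>k = -1\<close> these are elements of \<open>SU(2)\<close>, for \<open>k = 1\<close> of \<open>SU(1,1)\<close>; in general they are
  the \<open>W\<close> of determinant one with \<open>W diag(1, -k) W\<^sup>* = diag(1, -k)\<close>, up to nonvanishing of the entries.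
\<close>

definition su_form :: "real \<Rightarrow> cmat2 \<Rightarrow> bool" where
  "su_form k W \<longleftrightarrow> k \<noteq> 0 \<and> W$1$1 \<noteq> 0 \<and> W$1$2 \<noteq> 0 \<and> det W = 1 \<and>
     W$2$2 = cnj (W$1$1) \<and> W$2$1 = of_real k * cnj (W$1$2)"

lemma su_form_det:
  assumes "su_form k W"
  shows "k * (cmod (W$1$2))\<^sup>2 = (cmod (W$1$1))\<^sup>2 - 1"
proof -
  have W: "det W = 1" "W$2$2 = cnj (W$1$1)" "W$2$1 = of_real k * cnj (W$1$2)"
    using assms by (auto simp: su_form_def)
  have "complex_of_real ((cmod (W$1$1))\<^sup>2 - k * (cmod (W$1$2))\<^sup>2) = of_real 1"
    using W(1) unfolding of_real_diff of_real_mult complex_norm_square det_2 W(2,3)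
    by (simp add: algebra_simps)
  then show ?thesis by (simp only: of_real_eq_iff)
qed

text \<open>
  The dependency of \<open>W W\<^sup>* - 1\<close> and \<open>W E\<^sub>3 W\<^sup>* - E\<^sub>3\<close>, for \<open>W = (A, B; C, D)\<close>, written with the coefficients
  \<open>u\<close> and \<open>v\<close> of the light-like parts. Multiplying the off-diagonal equation by \<open>C D\<close> and eliminating
  \<open>C\<close> and \<open>B C\<close> by means of the other two leaves \<open>A D = \<bar>D\<bar>\<^sup>2\<close>.
\<close>

lemma edge_equations:
  fixes A B C D :: complex and u v :: real
  assumes det: "A * D - B * C = 1" and nz: "A \<noteq> 0" "B \<noteq> 0" "C \<noteq> 0" "D \<noteq> 0" "(u, v) \<noteq> (0, 0)"
    and off: "of_real u * (A * cnj C) + of_real v * (B * cnj D) = 0"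
    and diag: "of_real u * (C * cnj C) + of_real v * (D * cnj D - 1) = 0"
  shows "u \<noteq> 0" "v \<noteq> 0" "D = cnj A" "C = of_real (- v / u) * cnj B"
proof -
  show u: "u \<noteq> 0" using off nz by auto
  show v: "v \<noteq> 0" using off nz u by auto
  have "of_real v * (A * D - D * cnj D) =
      C * D * (of_real u * (A * cnj C) + of_real v * (B * cnj D))
      - A * D * (of_real u * (C * cnj C) + of_real v * (D * cnj D - 1))
      + of_real v * D * cnj D * (A * D - B * C - 1)"
    by (simp add: algebra_simps)
  then have "of_real v * (A * D - D * cnj D) = 0" using off diag det by simp
  then have "D * (A - cnj D) = 0" using v by (simp add: algebra_simps)
  then have AD: "A = cnj D" using nz by simp
  then show "D = cnj A" by simp
  have "A * (of_real u * cnj C + of_real v * B) = 0"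
    using off AD by (simp add: algebra_simps)
  then have "cnj (of_real u * cnj C + of_real v * B) = 0" using nz by simp
  then have "of_real u * C = - of_real v * cnj B" by (simp add: eq_neg_iff_add_eq_0)
  then show "C = of_real (- v / u) * cnj B" using u by (simp add: field_simps)
qed

lemma scaleR_sum_diff:
  fixes x n :: "'a::real_vector"
  shows "(b + c) *\<^sub>R (x + n) + (b - c) *\<^sub>R (x - n) = 2 *\<^sub>R (b *\<^sub>R x + c *\<^sub>R n)"
  unfolding scaleR_2 by (simp add: algebra_simps)

text \<open>
  In the frame \<open>G\<close> the Rodrigues equation becomes a linear dependency between the matrices \<open>W W\<^sup>* - 1\<close> and
  \<open>W E\<^sub>3 W\<^sup>* - E\<^sub>3\<close> of the transition \<open>W\<close>, because \<open>Y \<mapsto> G Y G\<^sup>*\<close> is injective.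
\<close>

lemma edge_frames:
  assumes fr: "framed X N G" "framed X' N' H"
    and dep: "(b, c) \<noteq> (0, 0)" "b *\<^sub>R (X' - X) + c *\<^sub>R (N' - N) = 0"
    and reg: "mink (X + N) (X' + N') \<noteq> 0" "mink (X - N) (X' - N') \<noteq> 0"
             "mink (X + N) (X' - N') \<noteq> 0" "mink (X - N) (X' + N') \<noteq> 0"
  obtains k where "su_form k (adj2 G ** H)"
    and "(X' + N') - (X + N) = k *\<^sub>R ((X' - N') - (X - N))"
proof -
  define W where "W = adj2 G ** H"
  have dG: "det G = 1" and dH: "det H = 1" using fr by (auto simp: framed_def)
  then have dW: "det W = 1" by (simp add: W_def det_mul)
  have H: "H = G ** W" by (simp add: W_def matrix_mul_assoc adj2_inverse dG)
  have nz: "W$1$1 \<noteq> 0" "W$1$2 \<noteq> 0" "W$2$1 \<noteq> 0" "W$2$2 \<noteq> 0"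
    using reg unfolding framed_sum[OF fr(1)] framed_sum[OF fr(2)] mink_outer W_def adj2_def
    by (simp_all add: matrix_mult_nth2 algebra_simps)
  define u v where "u = b + c" and "v = b - c"
  have uv: "(u, v) \<noteq> (0, 0)" using dep(1) by (auto simp: u_def v_def)
  define Y where "Y = mat (of_real b) ** (W ** conj_transpose W - mat 1)
                    + mat (of_real c) ** (W ** E3 ** conj_transpose W - E3)"
  have "G ** Y ** conj_transpose G = b *\<^sub>R (X' - X) + c *\<^sub>R (N' - N)"
  proof -
    have sc: "r *\<^sub>R Z = mat (of_real r) ** Z" for r and Z :: cmat2
      by (simp add: cmat2_eq_iff matrix_mult_nth2) (simp add: scaleR_conv_of_real)
    have mv: "G ** (mat r ** Z) ** K = mat r ** (G ** Z ** K)" for r and Z K :: cmat2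
      by (simp add: entries algebra_simps)
    have "X' = G ** (W ** conj_transpose W) ** conj_transpose G"
      "X = G ** mat 1 ** conj_transpose G"
      "N' = G ** (W ** E3 ** conj_transpose W) ** conj_transpose G"
      "N = G ** E3 ** conj_transpose G"
      using fr by (simp_all add: framed_def H conj_transpose_mult matrix_mul_assoc)
    then show ?thesis
      by (simp only: Y_def sc matrix_add_ldistrib mv matrix_add_rdistrib
          diff_conv_add_uminus) (simp add: entries algebra_simps)
  qed
  then have "Y = 0" using dep(2) congruence_cancel[OF dG] by simp
  then have Y0: "Y$1$2 = 0" "Y$2$2 = 0" by auto
  have off: "of_real u * (W$1$1 * cnj (W$2$1)) + of_real v * (W$1$2 * cnj (W$2$2)) = 0"
    using Y0(1) by (simp add: Y_def entries u_def v_def algebra_simps)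
  have diag: "of_real u * (W$2$1 * cnj (W$2$1)) + of_real v * (W$2$2 * cnj (W$2$2) - 1) = 0"
    using Y0(2) by (simp add: Y_def entries u_def v_def algebra_simps)
  have "W$1$1 * W$2$2 - W$1$2 * W$2$1 = 1" using dW by (simp add: det_2)
  note * = edge_equations[OF this nz uv off diag]
  have "u *\<^sub>R ((X' + N') - (X + N)) + v *\<^sub>R ((X' - N') - (X - N))
      = 2 *\<^sub>R (b *\<^sub>R (X' - X) + c *\<^sub>R (N' - N))"
    using scaleR_sum_diff[of b c "X' - X" "N' - N"] by (simp add: u_def v_def algebra_simps)
  then have "u *\<^sub>R ((X' + N') - (X + N)) = u *\<^sub>R ((- v / u) *\<^sub>R ((X' - N') - (X - N)))"
    using dep(2) *(1) by (simp add: eq_neg_iff_add_eq_0)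
  then have "(X' + N') - (X + N) = (- v / u) *\<^sub>R ((X' - N') - (X - N))"
    using *(1) scaleR_cancel_left by blast
  then show thesis
    using * nz dW by (intro that[of "- v / u"]) (auto simp: su_form_def W_def)
qed

section \<open>Duality and holonomy on faces\<close>

text \<open>
  Two coordinates of the edges \<open>e\<^sub>1, \<dots>, e\<^sub>4\<close> of a quadrilateral and of the parallel quadrilateral with
  edges \<open>k\<^sub>n e\<^sub>n\<close>. The two closing conditions leave one relation between \<open>e\<^sub>1, e\<^sub>2, e\<^sub>3\<close>, whose
  coefficients \<open>k\<^sub>n - k\<^sub>4\<close>, unless all zero, determine the triple of the \<open>e\<^sub>m \<and> e\<^sub>n\<close> up to a factor. Vanishing mixed area then
  says that this factor times \<open>k\<^sub>1 k\<^sub>3 - k\<^sub>2 k\<^sub>4\<close> is zero, and the factor is nonzero because the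
  quadrilateral with edges \<open>(1 + k\<^sub>n) e\<^sub>n\<close>, that is \<open>X\<close> up to scale, has area. If \<open>k\<^sub>1 = k\<^sub>2\<close>, then \<open>k\<^sub>3 = k\<^sub>4\<close>,
  and either the two quadrilaterals are homothetic, hence dual only without area, or a diagonal vanishes.
\<close>

lemma dual_quadrilateral:
  fixes x1 x2 x3 x4 y1 y2 y3 y4 k1 k2 k3 k4 :: real
  assumes x: "x1 + x2 + x3 + x4 = 0" "k1 * x1 + k2 * x2 + k3 * x3 + k4 * x4 = 0"
    and y: "y1 + y2 + y3 + y4 = 0" "k1 * y1 + k2 * y2 + k3 * y3 + k4 * y4 = 0"
    and k: "k1 \<noteq> 0"
    and dual: "((k1 * x1 + k2 * x2) * (y2 + y3) - (k1 * y1 + k2 * y2) * (x2 + x3))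
      + ((x1 + x2) * (k2 * y2 + k3 * y3) - (y1 + y2) * (k2 * x2 + k3 * x3)) = 0"
    and area: "((1 + k1) * x1 + (1 + k2) * x2) * ((1 + k2) * y2 + (1 + k3) * y3)
      - ((1 + k1) * y1 + (1 + k2) * y2) * ((1 + k2) * x2 + (1 + k3) * x3) \<noteq> 0"
  shows "k1 * k3 = k2 * k4" "k1 \<noteq> k2"
proof -
  define w12 w13 w23 where w: "w12 = x1 * y2 - x2 * y1" "w13 = x1 * y3 - x3 * y1"
      "w23 = x2 * y3 - x3 * y2"
  have x4: "x4 = - x1 - x2 - x3" and y4: "y4 = - y1 - y2 - y3" using x(1) y(1) by auto
  have rx: "(k1 - k4) * x1 + (k2 - k4) * x2 + (k3 - k4) * x3 = 0"
    using x(2) by (simp add: x4 algebra_simps)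
  have ry: "(k1 - k4) * y1 + (k2 - k4) * y2 + (k3 - k4) * y3 = 0"
    using y(2) by (simp add: y4 algebra_simps)
  have e1: "(k2 - k4) * w12 + (k3 - k4) * w13 = 0"
  proof -
    have "(k2 - k4) * w12 + (k3 - k4) * w13
        = x1 * ((k1 - k4) * y1 + (k2 - k4) * y2 + (k3 - k4) * y3)
        - y1 * ((k1 - k4) * x1 + (k2 - k4) * x2 + (k3 - k4) * x3)"
      by (simp add: w algebra_simps)
    then show ?thesis using rx ry by simp
  qed
  have e2: "(k1 - k4) * w12 = (k3 - k4) * w23"
  proof -
    have "(k1 - k4) * w12 - (k3 - k4) * w23
        = y2 * ((k1 - k4) * x1 + (k2 - k4) * x2 + (k3 - k4) * x3)
        - x2 * ((k1 - k4) * y1 + (k2 - k4) * y2 + (k3 - k4) * y3)"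
      by (simp add: w algebra_simps)
    then show ?thesis using rx ry by simp
  qed
  have e3: "(k1 - k4) * w13 + (k2 - k4) * w23 = 0"
  proof -
    have "(k1 - k4) * w13 + (k2 - k4) * w23
        = y3 * ((k1 - k4) * x1 + (k2 - k4) * x2 + (k3 - k4) * x3)
        - x3 * ((k1 - k4) * y1 + (k2 - k4) * y2 + (k3 - k4) * y3)"
      by (simp add: w algebra_simps)
    then show ?thesis using rx ry by simp
  qed
  have d: "(k1 + k2) * w12 + (k1 + k3) * w13 + (k2 + k3) * w23 = 0"
    using dual by (simp add: w algebra_simps)
  have a: "(1 + k1) * (1 + k2) * w12 + (1 + k1) * (1 + k3) * w13 + (1 + k2) * (1 + k3) * w23 \<noteq> 0"
    using area by (simp add: w algebra_simps)
  have "2 * (k1 * k3 - k2 * k4) * w12 = (k3 - k4) * ((k1 + k2) * w12 + (k1 + k3) * w13 + (k2 + k3) * w23)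
     - (k1 + k3) * ((k2 - k4) * w12 + (k3 - k4) * w13)
     + (k2 + k3) * ((k1 - k4) * w12 - (k3 - k4) * w23)"
    by (simp add: algebra_simps)
  then have c12: "(k1 * k3 - k2 * k4) * w12 = 0" using d e1 e2 by simp
  have "2 * (k1 * k3 - k2 * k4) * w13 = - (k2 - k4) * ((k1 + k2) * w12 + (k1 + k3) * w13 + (k2 + k3) * w23)
     + (k1 + k2) * ((k2 - k4) * w12 + (k3 - k4) * w13)
     + (k2 + k3) * ((k1 - k4) * w13 + (k2 - k4) * w23)"
    by (simp add: algebra_simps)
  then have c13: "(k1 * k3 - k2 * k4) * w13 = 0" using d e1 e3 by simp
  have "2 * (k1 * k3 - k2 * k4) * w23 = (k1 - k4) * ((k1 + k2) * w12 + (k1 + k3) * w13 + (k2 + k3) * w23)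
     - (k1 + k2) * ((k1 - k4) * w12 - (k3 - k4) * w23)
     - (k1 + k3) * ((k1 - k4) * w13 + (k2 - k4) * w23)"
    by (simp add: algebra_simps)
  then have c23: "(k1 * k3 - k2 * k4) * w23 = 0" using d e2 e3 by simp
  show k13: "k1 * k3 = k2 * k4"
  proof (rule ccontr)
    assume "k1 * k3 \<noteq> k2 * k4"
    then have "w12 = 0" "w13 = 0" "w23 = 0" using c12 c13 c23 by auto
    with a show False by simp
  qed
  show "k1 \<noteq> k2"
  proof
    assume k12: "k1 = k2"
    then have k34: "k3 = k4" using k13 k by simp
    show False
    proof (cases "k1 = k3")
      case True
      have "2 * k1 * (w12 + w13 + w23) = 0" using d k12 True by (simp add: algebra_simps)
      then have "w12 + w13 + w23 = 0" using k by simp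
      moreover have "(1 + k1) * (1 + k1) * (w12 + w13 + w23) \<noteq> 0"
        using a k12 True by (simp add: algebra_simps)
      ultimately show False by simp
    next
      case False
      have "(k1 - k3) * (x1 + x2) = 0" "(k1 - k3) * (y1 + y2) = 0"
        using rx ry k12 k34 by (simp_all add: algebra_simps)
      then have "x2 = - x1" "y2 = - y1" using False by auto
      then show False using area k12 by simp
    qed
  qed
qed

lemma face_curvatures:
  assumes flat: "has_gauss_curvature X N (i, j, k, l) 1"
    and e1: "df (\<lambda>i. X i + N i) i j = k1 *\<^sub>R df (\<lambda>i. X i - N i) i j"
    and e2: "df (\<lambda>i. X i + N i) j k = k2 *\<^sub>R df (\<lambda>i. X i - N i) j k"
    and e3: "df (\<lambda>i. X i + N i) l k = k3 *\<^sub>R df (\<lambda>i. X i - N i) l k"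
    and e4: "df (\<lambda>i. X i + N i) i l = k4 *\<^sub>R df (\<lambda>i. X i - N i) i l"
    and k: "k1 \<noteq> 0"
  shows "k1 * k3 = k2 * k4" "k1 \<noteq> k2" "X i \<noteq> X k"
proof -
  obtain p q where area: "mixed_area X X (i, j, k, l) p q \<noteq> 0"
    using flat by (auto simp: has_gauss_curvature_def)
  have dual: "mixed_area (\<lambda>i. X i + N i) (\<lambda>i. X i - N i) (i, j, k, l) p q = 0"
    using flat by (auto simp: has_gauss_curvature_def)
  show "X i \<noteq> X k" using area by (auto simp: wedge_def)
  define m where "m r i = (X i - N i) \<bullet> r" for r i
  define s where "s r i = (X i + N i) \<bullet> r" for r i
  have X: "X i \<bullet> r = (s r i + m r i) / 2" for r i
    by (simp add: s_def m_def inner_left_distrib inner_diff_left)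
  have s: "s r j = s r i + k1 * (m r j - m r i)" "s r k = s r j + k2 * (m r k - m r j)"
     "s r k = s r l + k3 * (m r k - m r l)" "s r l = s r i + k4 * (m r l - m r i)" for r
    using arg_cong[OF e1, of "\<lambda>v. v \<bullet> r"] arg_cong[OF e2, of "\<lambda>v. v \<bullet> r"]
      arg_cong[OF e3, of "\<lambda>v. v \<bullet> r"] arg_cong[OF e4, of "\<lambda>v. v \<bullet> r"]
    by (simp_all add: s_def m_def inner_left_distrib inner_diff_left algebra_simps)
  have clo: "k1 * (m r j - m r i) + k2 * (m r k - m r j) + k3 * (m r l - m r k) + k4 * (m r i - m r l) = 0" for r
    using s[of r] by (simp add: algebra_simps)
  have ik: "s r k - s r i = k1 * (m r j - m r i) + k2 * (m r k - m r j)" for r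
    using s[of r] by simp
  have jl: "s r l - s r j = k2 * (m r k - m r j) + k3 * (m r l - m r k)" for r
    using s[of r] by (simp add: algebra_simps)
  have D: "((s p k - s p i) * (m q l - m q j) - (s q k - s q i) * (m p l - m p j))
     + ((m p k - m p i) * (s q l - s q j) - (m q k - m q i) * (s p l - s p j)) = 0"
    using dual by (simp add: wedge_def s_def m_def inner_diff_left inner_left_distrib algebra_simps)
  have Ar: "(s p k - s p i + (m p k - m p i)) * (s q l - s q j + (m q l - m q j))
     - (s q k - s q i + (m q k - m q i)) * (s p l - s p j + (m p l - m p j)) \<noteq> 0"
    using area by (simp add: wedge_def inner_diff_left X field_simps)
  note * = dual_quadrilateral[of "m p j - m p i" "m p k - m p j" "m p l - m p k" "m p i - m p l" k1 k2 k3 k4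
      "m q j - m q i" "m q k - m q j" "m q l - m q k" "m q i - m q l"]
  have "k1 * k3 = k2 * k4 \<and> k1 \<noteq> k2"
    by (intro conjI; rule *) (use clo k D Ar in \<open>simp_all only: ik jl, simp_all add: algebra_simps\<close>)
  then show "k1 * k3 = k2 * k4" "k1 \<noteq> k2" by auto
qed

text \<open>
  Let \<open>m\<close> and \<open>n\<close> be the products of off-diagonal entries on the two sides. The two diagonal entries of the
  closing condition carry them with different factors, \<open>(k\<^sub>2, k\<^sub>3)\<close> and \<open>(k\<^sub>1, k\<^sub>4)\<close>. Subtracting
  gives \<open>(k\<^sub>1 - k\<^sub>2) m = (k\<^sub>4 - k\<^sub>3) n\<close>, and by \<open>k\<^sub>1 k\<^sub>3 = k\<^sub>2 k\<^sub>4\<close> this is \<open>k\<^sub>2 m = k\<^sub>3 n\<close> multiplied by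
  \<open>(k\<^sub>1 - k\<^sub>2) / k\<^sub>2\<close>.
\<close>

lemma face_holonomy:
  assumes su: "su_form k1 W1" "su_form k2 W2" "su_form k3 W3" "su_form k4 W4"
    and close: "W1 ** W2 = W4 ** W3"
    and k: "k1 * k3 = k2 * k4" "k1 \<noteq> k2"
  shows "W1$1$1 * W2$1$1 = W4$1$1 * W3$1$1"
    and "of_real k2 * (W1$1$2 * cnj (W2$1$2)) = of_real k3 * (W4$1$2 * cnj (W3$1$2))"
proof -
  define m n where "m = W1$1$2 * cnj (W2$1$2)" and "n = W4$1$2 * cnj (W3$1$2)"
  have c: "(W1 ** W2) $1$1 = (W4 ** W3) $1$1" "cnj ((W1 ** W2) $2$2) = cnj ((W4 ** W3) $2$2)"
    using close by auto
  have 1: "W1$1$1 * W2$1$1 + of_real k2 * m = W4$1$1 * W3$1$1 + of_real k3 * n"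
    using c(1) su by (simp add: matrix_mult_nth2 su_form_def m_def n_def algebra_simps)
  have 2: "W1$1$1 * W2$1$1 + of_real k1 * m = W4$1$1 * W3$1$1 + of_real k4 * n"
    using c(2) su by (simp add: matrix_mult_nth2 su_form_def m_def n_def algebra_simps)
  have 3: "of_real k1 * m - of_real k2 * m = of_real k4 * n - of_real k3 * n"
    using arg_cong2[OF 2 1, of "(-)"] by simp
  have kc: "complex_of_real k1 * of_real k3 = of_real k2 * of_real k4"
    using k(1) by (metis of_real_mult)
  have "(of_real k1 - of_real k2) * (of_real k2 * m - of_real k3 * n) =
     of_real k2 * ((of_real k1 * m - of_real k2 * m) - (of_real k4 * n - of_real k3 * n))
     - n * (complex_of_real k1 * of_real k3 - of_real k2 * of_real k4)"
    by (simp add: algebra_simps)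
  also have "\<dots> = 0" unfolding 3 kc by simp
  finally have "of_real k2 * m = of_real k3 * n" using k(2) by simp
  with 1 show "W1$1$1 * W2$1$1 = W4$1$1 * W3$1$1"
    "of_real k2 * (W1$1$2 * cnj (W2$1$2)) = of_real k3 * (W4$1$2 * cnj (W3$1$2))"
    by (simp_all add: m_def n_def)
qed


section \<open>Gauge fixing and the Weierstrass representation\<close>

abbreviation transition :: "('v \<Rightarrow> cmat2) \<Rightarrow> 'v \<Rightarrow> 'v \<Rightarrow> cmat2" where
  "transition F i j \<equiv> adj2 (F i) ** F j"

lemma transition_reverse:
  "transition F j i $ 1 $ 1 = transition F i j $ 2 $ 2"
  "transition F j i $ 1 $ 2 = - transition F i j $ 1 $ 2"
  by (simp_all add: adj2_def matrix_mult_nth2 algebra_simps)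

lemma su_form_unique:
  assumes "su_form k W" "su_form k' W'" "W$1$1 = W'$1$1" "W$1$2 = W'$1$2"
  shows "W = W'"
proof -
  have "k * (cmod (W$1$2))\<^sup>2 = k' * (cmod (W$1$2))\<^sup>2"
    using su_form_det[OF assms(1)] su_form_det[OF assms(2)] assms(3,4) by simp
  then have "k = k'" using assms(1) by (simp add: su_form_def)
  then show ?thesis using assms by (simp add: cmat2_eq_iff su_form_def)
qed

text \<open>
  With \<open>a = 1 - 1/r\<^sup>2\<close> the argument of the square root is positive, and
  \<open>det W = 1\<close> turns the lower left entry \<open>a / dg\<close> of the normalized matrix into the one of \<open>W\<close>.
\<close>

lemma weierstrass_form:
  assumes W: "su_form k W" and A: "W$1$1 = of_real r" "r > 0"
  shows "W = weierstrass_matrix 1 (1 - 1 / r\<^sup>2) (W$1$2 / W$1$1)"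
proof -
  have c: "1 / csqrt (of_real (1 - 1 * (1 - 1 / r\<^sup>2))) = of_real r"
    using A(2) by (simp add: real_sqrt_divide csqrt_of_real_nonneg flip: of_real_power of_real_divide)
      (simp add: of_real_divide)
  have B: "W$1$2 \<noteq> 0" and W': "W$2$2 = of_real r" "W$2$1 = of_real k * cnj (W$1$2)"
    using W A(1) by (auto simp: su_form_def)
  have "r\<^sup>2 - 1 = k * (cmod (W$1$2))\<^sup>2"
    using su_form_det[OF W] A by simp
  then have "complex_of_real (r\<^sup>2 - 1) = of_real k * (W$1$2 * cnj (W$1$2))"
    by (simp only: of_real_mult complex_norm_square)
  moreover have "complex_of_real (1 - 1 / r\<^sup>2) = of_real (r\<^sup>2 - 1) / (of_real r * of_real r)"
    using A(2) by (simp add: field_simps power2_eq_square)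
  ultimately have "of_real r * (complex_of_real (1 - 1 / r\<^sup>2) / (W$1$2 / of_real r)) = W$2$1"
    using B A(2) by (simp add: W')
  then show ?thesis
    using A(2) unfolding weierstrass_matrix_def c by (simp add: entries A(1) W'(1) del: of_real_diff)
qed

lemma framed_gauge:
  assumes "framed X N F" "u * cnj u = 1"
  shows "framed X N (F ** mat2 u 0 0 (cnj u))"
proof -
  have ph: "u * (x * (cnj u * y)) = x * y" "u * (cnj u * x) = x" "cnj u * (u * x) = x" for x y
    using assms(2) by (metis mult.assoc mult.commute mult_1)+
  have D: "det (mat2 u 0 0 (cnj u)) = 1"
    and D0: "mat2 u 0 0 (cnj u) ** conj_transpose (mat2 u 0 0 (cnj u)) = mat 1"
    and D3: "mat2 u 0 0 (cnj u) ** E3 ** conj_transpose (mat2 u 0 0 (cnj u)) = E3"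
    using assms(2) by (simp_all add: det_2 entries mult.commute)
  have "F ** mat2 u 0 0 (cnj u) ** conj_transpose (F ** mat2 u 0 0 (cnj u))
      = F ** (mat2 u 0 0 (cnj u) ** conj_transpose (mat2 u 0 0 (cnj u))) ** conj_transpose F"
    "F ** mat2 u 0 0 (cnj u) ** E3 ** conj_transpose (F ** mat2 u 0 0 (cnj u))
      = F ** (mat2 u 0 0 (cnj u) ** E3 ** conj_transpose (mat2 u 0 0 (cnj u))) ** conj_transpose F"
    by (simp_all only: conj_transpose_mult matrix_mul_assoc)
  then show ?thesis
    using assms(1) by (simp add: framed_def det_mul D D0 D3)
qed

locale regular_flat_front =
  fixes V :: "'v set" and E :: "('v \<times> 'v) set" and Q :: "('v \<times> 'v \<times> 'v \<times> 'v) set"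
    and X N :: "'v \<Rightarrow> cmat2"
  assumes complex: "quad_complex V E Q"
    and simply_connected: "quad_simply_connected V E Q"
    and front: "discrete_flat_front V E Q X N"
    and regular: "regular_front E X N"
begin

lemma face_edges:
  assumes "(i, j, k, l) \<in> Q"
  shows "(i, j) \<in> E" "(j, k) \<in> E" "(l, k) \<in> E" "(i, l) \<in> E" "(j, k, l, i) \<in> Q"
  using assms complex by (fastforce simp: quad_complex_def sym_def)+

definition framing :: "('v \<Rightarrow> cmat2) \<Rightarrow> bool" where
  "framing F \<longleftrightarrow> (\<forall>i\<in>V. framed (X i) (N i) (F i))"

lemma framing_exists: "\<exists>F. framing F"
proof -
  have "\<forall>i\<in>V. \<exists>G. framed (X i) (N i) G"
    using front frame_exists unfolding discrete_flat_front_def by blast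
  then show ?thesis unfolding framing_def by (rule bchoice)
qed

lemma edge_transition:
  assumes F: "framing F" and ij: "(i, j) \<in> E"
  obtains k where "su_form k (transition F i j)"
    and "df (\<lambda>i. X i + N i) i j = k *\<^sub>R df (\<lambda>i. X i - N i) i j"
proof -
  have V: "i \<in> V" "j \<in> V" using ij complex by (auto simp: quad_complex_def)
  obtain b c where bc: "(b, c) \<noteq> (0, 0)" "b *\<^sub>R df X i j + c *\<^sub>R df N i j = 0"
    using front ij unfolding discrete_flat_front_def discrete_legendre_def by blast
  have reg: "mink (X i + N i) (X j + N j) \<noteq> 0" "mink (X i - N i) (X j - N j) \<noteq> 0"
      "mink (X i + N i) (X j - N j) \<noteq> 0" "mink (X i - N i) (X j + N j) \<noteq> 0"
    using regular ij by (auto simp: regular_front_def)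
  have fr: "framed (X i) (N i) (F i)" "framed (X j) (N j) (F j)"
    using F V by (auto simp: framing_def)
  show thesis using edge_frames[OF fr bc reg] that by blast
qed

lemma transition_mult:
  assumes "framing F" "j \<in> V"
  shows "transition F i j ** transition F j k = transition F i k"
proof -
  have "det (F j) = 1" using assms by (simp add: framing_def framed_def)
  then have "adj2 (F i) ** (F j ** adj2 (F j)) ** F k = transition F i k"
    by (simp add: adj2_inverse)
  then show ?thesis by (simp add: matrix_mul_assoc)
qed

lemma face_transition:
  assumes F: "framing F" and Q: "(i, j, k, l) \<in> Q"
  obtains k1 k2 k3 k4 where
    "su_form k1 (transition F i j)" "su_form k2 (transition F j k)"
    "su_form k3 (transition F l k)" "su_form k4 (transition F i l)"
    "transition F i j $1$1 * transition F j k $1$1 = transition F i l $1$1 * transition F l k $1$1"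
    "of_real k2 * (transition F i j $1$2 * cnj (transition F j k $1$2))
      = of_real k3 * (transition F i l $1$2 * cnj (transition F l k $1$2))"
    "transition F i j ** transition F j k = transition F i l ** transition F l k"
    "F i \<noteq> F k"
proof -
  note E = face_edges[OF Q]
  have V: "i \<in> V" "j \<in> V" "k \<in> V" "l \<in> V" using E complex by (auto simp: quad_complex_def)
  obtain k1 where k1: "su_form k1 (transition F i j)" "df (\<lambda>i. X i + N i) i j = k1 *\<^sub>R df (\<lambda>i. X i - N i) i j"
    using edge_transition[OF F E(1)] .
  obtain k2 where k2: "su_form k2 (transition F j k)" "df (\<lambda>i. X i + N i) j k = k2 *\<^sub>R df (\<lambda>i. X i - N i) j k"
    using edge_transition[OF F E(2)] .
  obtain k3 where k3: "su_form k3 (transition F l k)" "df (\<lambda>i. X i + N i) l k = k3 *\<^sub>R df (\<lambda>i. X i - N i) l k"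
    using edge_transition[OF F E(3)] .
  obtain k4 where k4: "su_form k4 (transition F i l)" "df (\<lambda>i. X i + N i) i l = k4 *\<^sub>R df (\<lambda>i. X i - N i) i l"
    using edge_transition[OF F E(4)] .
  have flat: "has_gauss_curvature X N (i, j, k, l) 1"
    using front Q by (auto simp: discrete_flat_front_def)
  have "k1 \<noteq> 0" using k1 by (simp add: su_form_def)
  note c = face_curvatures[OF flat k1(2) k2(2) k3(2) k4(2) this]
  have cl: "transition F i j ** transition F j k = transition F i l ** transition F l k"
    by (simp add: transition_mult[OF F] V)
  have "F i \<noteq> F k"
    using c(3) F V by (auto simp: framing_def framed_def)
  with face_holonomy[OF k1(1) k2(1) k3(1) k4(1) cl c(1,2)] show thesis
    using that k1 k2 k3 k4 cl by blast
qed

text \<open>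
  Besides \<open>A\<^sub>i\<^sub>j A\<^sub>j\<^sub>k = A\<^sub>i\<^sub>l A\<^sub>l\<^sub>k\<close>, the face read from its next corner gives \<open>A\<^sub>j\<^sub>k A\<^sub>k\<^sub>l = A\<^sub>j\<^sub>i A\<^sub>i\<^sub>l\<close>. Reversing an edge
  conjugates \<open>A\<close>, so these are two equations for the same four moduli.
\<close>

lemma face_moduli:
  assumes F: "framing F" and Q: "(i, j, k, l) \<in> Q"
  shows "cmod (transition F i j $1$1) = cmod (transition F l k $1$1)"
    and "cmod (transition F j k $1$1) = cmod (transition F i l $1$1)"
proof -
  obtain k1 k2 k3 k4 where
    su: "su_form k1 (transition F i j)" "su_form k2 (transition F j k)"
    "su_form k3 (transition F l k)" "su_form k4 (transition F i l)" and
    1: "transition F i j $1$1 * transition F j k $1$1 = transition F i l $1$1 * transition F l k $1$1"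
    using face_transition[OF F Q] .
  have "transition F j k $1$1 * transition F k l $1$1 = transition F j i $1$1 * transition F i l $1$1"
    using face_transition[OF F face_edges(5)[OF Q]] .
  then have 2: "transition F j k $1$1 * cnj (transition F l k $1$1)
      = cnj (transition F i j $1$1) * transition F i l $1$1"
    using su by (simp add: transition_reverse(1)[of F k l] transition_reverse(1)[of F j i] su_form_def)
  define a b c d where "a = cmod (transition F i j $1$1)" and "b = cmod (transition F j k $1$1)"
    and "c = cmod (transition F l k $1$1)" and "d = cmod (transition F i l $1$1)"
  have pos: "a > 0" "b > 0" "c > 0" "d > 0"
    using su by (auto simp: a_def b_def c_def d_def su_form_def)
  have ab: "a * b = d * c" using arg_cong[OF 1, of cmod] by (simp add: norm_mult a_def b_def c_def d_def)
  have bc: "b * c = a * d" using arg_cong[OF 2, of cmod] by (simp add: norm_mult a_def b_def c_def d_def)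
  have "a * c * (b * b) = (a * b) * (b * c)" by simp
  also have "\<dots> = a * c * (d * d)" unfolding ab bc by simp
  finally have "b * b = d * d" using pos by simp
  then have "b = d" using pos by (simp add: square_eq_iff)
  with ab pos have "a = c" by simp
  with \<open>b = d\<close> show "cmod (transition F i j $1$1) = cmod (transition F l k $1$1)"
    "cmod (transition F j k $1$1) = cmod (transition F i l $1$1)"
    by (simp_all add: a_def b_def c_def d_def)
qed

text \<open>
  Under \<open>F\<^sub>i \<mapsto> F\<^sub>i diag(u\<^sub>i, u\<^sub>i\<^sup>-\<^sup>1)\<close> the diagonal entry \<open>A\<^sub>i\<^sub>j\<close> is multiplied by \<open>u\<^sub>j / u\<^sub>i\<close>, so the phases of the
  entries \<open>A\<close> have to be a coboundary. They are closed on faces by the product formula of \<open>face_transition\<close>.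
\<close>

lemma positive_framing_exists:
  obtains F where "framing F"
    and "\<And>i j. (i, j) \<in> E \<Longrightarrow> transition F i j $1$1 = of_real (cmod (transition F i j $1$1))"
proof -
  obtain G where G: "framing G" using framing_exists by blast
  define h where "h i j = cnj (sgn (transition G i j $1$1))" for i j
  have nz: "transition G i j $1$1 \<noteq> 0" "transition G j i $1$1 = cnj (transition G i j $1$1)"
    if "(i, j) \<in> E" for i j
    using edge_transition[OF G that] transition_reverse(1)[of G j i] by (auto simp: su_form_def)
  have unit: "h i j * cnj (h i j) = 1" if "(i, j) \<in> E" for i j
    using nz(1)[OF that] by (simp add: h_def norm_sgn flip: complex_norm_square)
      (metis complex_norm_square complex_mod_cnj mult.commute norm_sgn of_real_1 one_power2)
  interpret flat_transport V E Q "\<lambda>i j z. z * h i j"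
  proof
    fix i j z assume ij: "(i, j) \<in> E"
    have "h j i = cnj (h i j)" unfolding h_def nz(2)[OF ij] by (simp add: sgn_eq)
    then show "z * h i j * h j i = z" using unit[OF ij] by (simp add: mult.assoc)
  next
    fix i j k l z assume "(i, j, k, l) \<in> Q"
    then have "transition G i j $1$1 * transition G j k $1$1 = transition G i l $1$1 * transition G l k $1$1"
      using face_transition[OF G] by blast
    then have "h i j * h j k = h i l * h l k"
      by (simp add: h_def flip: complex_cnj_mult sgn_mult)
    then show "z * h i j * h j k = z * h i l * h l k" by (simp add: mult.assoc)
  qed (rule complex simply_connected)+
  obtain u where u: "\<And>i. i \<in> V \<Longrightarrow> u i \<in> {z. z * cnj z = 1}"
    and uh: "\<And>i j. (i, j) \<in> E \<Longrightarrow> u j = u i * h i j"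
  proof (rule parallel_section[where S = "{z. z * cnj z = 1}" and ?z0.0 = 1])
    fix i j z assume ij: "(i, j) \<in> E" and z: "z \<in> {z. z * cnj z = 1}"
    have "z * h i j * cnj (z * h i j) = (z * cnj z) * (h i j * cnj (h i j))" by simp
    also have "\<dots> = 1" using z unit[OF ij] by (simp only: mem_Collect_eq mult_1)
    finally show "z * h i j \<in> {z. z * cnj z = 1}" by (rule CollectI)
  qed auto
  define F where "F i = G i ** mat2 (u i) 0 0 (cnj (u i))" for i
  show thesis
  proof
    show "framing F"
      using G u by (auto simp: framing_def F_def intro!: framed_gauge)
  next
    fix i j assume ij: "(i, j) \<in> E"
    then have V: "i \<in> V" using complex by (auto simp: quad_complex_def)
    have "transition F i j $1$1 = cnj (u i) * transition G i j $1$1 * u j"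
      by (simp add: F_def adj2_def matrix_mult_nth2 algebra_simps)
    also have "\<dots> = (u i * cnj (u i)) * (transition G i j $1$1 * h i j)"
      by (simp add: uh[OF ij] ac_simps)
    also have "\<dots> = transition G i j $1$1 * h i j"
      using u[OF V] by simp
    also have "\<dots> = of_real (cmod (transition G i j $1$1))"
      using nz(1)[OF ij] by (simp add: h_def sgn_eq flip: complex_norm_square)
        (simp add: power2_eq_square)
    finally show "transition F i j $1$1 = of_real (cmod (transition F i j $1$1))" by simp
  qed
qed

lemma weierstrass_representation:
  "\<exists>(g :: 'v \<Rightarrow> complex) (a :: 'v \<Rightarrow> 'v \<Rightarrow> real) F.
      discrete_holomorphic E Q g a \<and> (\<forall>(i, j) \<in> E. a i j \<noteq> 1) \<and>
      framing F \<and>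
      (\<forall>(i, j) \<in> E. df g i j \<noteq> 0 \<and> F j = F i ** weierstrass_matrix 1 (a i j) (df g i j))"
proof -
  obtain F where F: "framing F" and pos: "\<And>i j. (i, j) \<in> E \<Longrightarrow>
      transition F i j $1$1 = of_real (cmod (transition F i j $1$1))"
    using positive_framing_exists by blast
  define r where "r i j = cmod (transition F i j $1$1)" for i j
  define B where "B i j = transition F i j $1$2" for i j
  have A: "transition F i j $1$1 = of_real (r i j)" "r i j > 0" "B i j \<noteq> 0"
    "r j i = r i j" "B j i = - B i j" if ij: "(i, j) \<in> E" for i j
  proof -
    obtain k where "su_form k (transition F i j)" using edge_transition[OF F ij] .
    then show "r i j > 0" "B i j \<noteq> 0" "r j i = r i j"
      by (auto simp: su_form_def r_def B_def transition_reverse(1)[of F j i])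
    show "B j i = - B i j" by (simp add: B_def transition_reverse(2)[of F j i])
    show "transition F i j $1$1 = of_real (r i j)" using pos[OF ij] by (simp add: r_def)
  qed
  have rf: "r l k = r i j" "r i l = r j k" if "(i, j, k, l) \<in> Q" for i j k l
    using face_moduli[OF F that] by (simp_all add: r_def)
  \<comment> \<open>divided by \<open>r i j * r j k\<close> this is the closedness of \<open>B / r\<close>\<close>
  have Bf: "r i j * B j k + r j k * B i j = r j k * B l k + r i j * B i l"
    if Q: "(i, j, k, l) \<in> Q" for i j k l
  proof -
    obtain k1 k2 k3 k4 where
      su: "su_form k1 (transition F i j)" "su_form k2 (transition F j k)"
      "su_form k3 (transition F l k)" "su_form k4 (transition F i l)" and
      eq: "transition F i j ** transition F j k = transition F i l ** transition F l k"
      using face_transition[OF F Q] .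
    note E = face_edges[OF Q]
    have "(transition F i j ** transition F j k)$1$2 = (transition F i l ** transition F l k)$1$2"
      using eq by simp
    moreover have "transition F j k $2$2 = of_real (r j k)" "transition F l k $2$2 = of_real (r i j)"
      using su A(1)[OF E(2)] A(1)[OF E(3)] rf[OF Q] by (auto simp: su_form_def)
    ultimately show ?thesis
      using A(1)[OF E(1)] A(1)[OF E(4)] rf[OF Q]
      by (simp add: matrix_mult_nth2[of "transition F _ _"] B_def[symmetric] mult.commute)
  qed
  interpret flat_transport V E Q "\<lambda>i j z. z + B i j / r i j"
  proof
    fix i j z assume ij: "(i, j) \<in> E"
    show "z + B i j / r i j + B j i / r j i = z" using A[OF ij] by simp
  next
    fix i j k l z assume Q: "(i, j, k, l) \<in> Q"
    have "B i j / r i j + B j k / r j k = B i l / r i l + B l k / r l k"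
      using Bf[OF Q] A(2)[OF face_edges(1)[OF Q]] A(2)[OF face_edges(2)[OF Q]]
      by (simp add: rf[OF Q] field_simps)
    then show "z + B i j / r i j + B j k / r j k = z + B i l / r i l + B l k / r l k"
      by (simp add: add.assoc)
  qed (rule complex simply_connected)+
  obtain g where "\<And>i j. (i, j) \<in> E \<Longrightarrow> g j = g i + B i j / r i j"
    using parallel_section[where S = UNIV] by auto
  then have dg: "df g i j = B i j / r i j" if "(i, j) \<in> E" for i j using that by simp
  define a where "a i j = 1 - 1 / (r i j)\<^sup>2" for i j
  have ak: "complex_of_real (a i j) * (of_real (r i j))\<^sup>2 = of_real k * (B i j * cnj (B i j))" 
    if "(i, j) \<in> E" "su_form k (transition F i j)" for i j k
  proof -
    have "a i j * (r i j)\<^sup>2 = (r i j)\<^sup>2 - 1"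
      using A(2)[OF that(1)] by (simp add: a_def left_diff_distrib)
    also have "\<dots> = k * (cmod (B i j))\<^sup>2"
      using su_form_det[OF that(2)] by (simp add: B_def r_def)
    finally have "a i j * (r i j)\<^sup>2 = k * (cmod (B i j))\<^sup>2" .
    then have "complex_of_real (a i j * (r i j)\<^sup>2) = of_real (k * (cmod (B i j))\<^sup>2)" by simp
    then show ?thesis unfolding of_real_mult complex_norm_square of_real_power[symmetric] .
  qed
  have "discrete_holomorphic E Q g a"
    unfolding discrete_holomorphic_def edge_labelling_def
  proof (intro conjI ballI; clarify)
    fix i j assume "(i, j) \<in> E"
    then show "a i j = a j i" using A(4) by (simp add: a_def)
  next
    fix i j k l assume Q: "(i, j, k, l) \<in> Q"
    then show "a i j = a k l" using A(4)[OF face_edges(3)[OF Q]] rf[OF Q] by (simp add: a_def)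
  next
    fix i j k l assume Q: "(i, j, k, l) \<in> Q"
    note E = face_edges[OF Q]
    obtain k1 k2 k3 k4 where
      su: "su_form k1 (transition F i j)" "su_form k2 (transition F j k)"
      "su_form k3 (transition F l k)" "su_form k4 (transition F i l)" and
      eq: "of_real k2 * (B i j * cnj (B j k)) = of_real k3 * (B i l * cnj (B l k))"
      and Fik: "F i \<noteq> F k"
      using face_transition[OF F Q] unfolding B_def .
    have Fjl: "F j \<noteq> F l" using face_transition[OF F E(5)] .
    define x y where "x = complex_of_real (r i j)" and "y = complex_of_real (r j k)"
    have xy: "x \<noteq> 0" "y \<noteq> 0" using A(2)[OF E(1)] A(2)[OF E(2)] by (auto simp: x_def y_def)
    have E': "(k, l) \<in> E" "(l, i) \<in> E" using Q complex by (auto simp: quad_complex_def)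
    have d: "df g i j = B i j / x" "df g j k = B j k / y" "df g k l = - B l k / x" "df g l i = - B i l / y"
      unfolding dg[OF E(1)] dg[OF E(2)] dg[OF E'(1)] dg[OF E'(2)]
      using A(4,5)[OF E(3)] A(4,5)[OF E(4)] by (simp_all add: x_def y_def rf[OF Q])
    have nz: "B i j \<noteq> 0" "B j k \<noteq> 0" "B l k \<noteq> 0" "B i l \<noteq> 0" using A(3) E by auto
    have k2: "k2 \<noteq> 0" using su by (simp add: su_form_def)
    have a1: "of_real (a i j) * x\<^sup>2 = of_real k3 * (B l k * cnj (B l k))"
      using ak[OF E(3) su(3)] by (simp add: x_def a_def rf[OF Q])
    have a2: "of_real (a j k) * y\<^sup>2 = of_real k2 * (B j k * cnj (B j k))"
      using ak[OF E(2) su(2)] by (simp add: y_def)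
    have "complex_of_real (a j k) \<noteq> 0" using a2 k2 nz by auto
    have cr: "(df g i j / df g j k) * (df g k l / df g l i) = of_real (a i j / a j k)"
    proof -
      have "(B i j * B l k * y\<^sup>2 * of_real (a j k)) * cnj (B j k) = B l k * B j k * cnj (B j k) *
           (of_real k2 * (B i j * cnj (B j k)))"
        using a2 by (simp add: ac_simps)
      also have "\<dots> = (B j k * B i l) * cnj (B j k) * (of_real k3 * (B l k * cnj (B l k)))"
        unfolding eq by (simp add: ac_simps)
      also have "\<dots> = (B j k * B i l * x\<^sup>2 * of_real (a i j)) * cnj (B j k)"
        unfolding a1[symmetric] by (simp add: ac_simps)
      finally have "B i j * B l k * y\<^sup>2 * of_real (a j k) = B j k * B i l * x\<^sup>2 * of_real (a i j)"
        using nz by simp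
      then show ?thesis
        unfolding d using nz xy \<open>complex_of_real (a j k) \<noteq> 0\<close>
        by (simp add: field_simps power2_eq_square)
    qed
    have "df g i j \<noteq> 0" "df g j k \<noteq> 0" "df g k l \<noteq> 0" "df g l i \<noteq> 0"
      unfolding d using nz xy by auto
    moreover have "(df g i j / df g j k) * (df g k l / df g l i) \<noteq> 1"
    proof
      \<comment> \<open>all four \<open>r\<close> coincide, and two transitions with a common source have equal entries,
        so they lead to the same frame\<close>
      assume one: "(df g i j / df g j k) * (df g k l / df g l i) = 1"
      have "a i j = a j k" using cr one by (simp flip: of_real_divide)
      then have "(r i j)\<^sup>2 = (r j k)\<^sup>2" by (simp add: a_def)
      then have req: "r i j = r j k" using A(2)[OF E(1)] A(2)[OF E(2)] by simp
      then have "B i j * B l k = B j k * B i l"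
        using one nz xy unfolding d by (simp add: x_def y_def field_simps)
      moreover have sum: "B j k + B i j = B l k + B i l"
        using Bf[OF Q] req xy(1) by (simp add: x_def flip: distrib_left)
      moreover have "(B i j + B j k) * (B l k - B j k)
          = (B i j * B l k - B j k * B i l) - B j k * ((B j k + B i j) - (B l k + B i l))"
        by (simp add: algebra_simps)
      ultimately have "(B i j + B j k) * (B l k - B j k) = 0" by simp
      then consider "B i j + B j k = 0" | "B l k = B j k" by auto
      then show False
      proof cases
        case 1
        have "(j, i) \<in> E" using E(1) complex by (auto simp: quad_complex_def sym_def)
        obtain k0 where "su_form k0 (transition F j i)" using edge_transition[OF F \<open>(j, i) \<in> E\<close>] .
        moreover have "transition F j i $1$1 = transition F j k $1$1"
          using A(1)[OF \<open>(j, i) \<in> E\<close>] A(1)[OF E(2)] A(4)[OF E(1)] req by simp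
        moreover have "transition F j i $1$2 = transition F j k $1$2"
          using minus_unique[OF 1] A(5)[OF E(1)] by (simp add: B_def)
        ultimately have "transition F j i = transition F j k"
          using su_form_unique su(2) by blast
        then have "F j ** transition F j i = F j ** transition F j k" by simp
        moreover have "det (F j) = 1"
          using F E(1) complex by (auto simp: framing_def framed_def quad_complex_def)
        ultimately show False using Fik by (simp add: matrix_mul_assoc adj2_inverse)
      next
        case 2
        then have "transition F i j $1$2 = transition F i l $1$2" using sum by (simp add: B_def)
        moreover have "transition F i j $1$1 = transition F i l $1$1"
          using A(1)[OF E(1)] A(1)[OF E(4)] rf[OF Q] req by simp
        ultimately have "transition F i j = transition F i l"
          using su_form_unique su(1,4) by blast
        then have "F i ** transition F i j = F i ** transition F i l" by simp
        moreover have "det (F i) = 1"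
          using F E(1) complex by (auto simp: framing_def framed_def quad_complex_def)
        ultimately show False using Fjl by (simp add: matrix_mul_assoc adj2_inverse)
      qed
    qed
    ultimately show "df g i j \<noteq> 0 \<and> df g j k \<noteq> 0 \<and> df g k l \<noteq> 0 \<and> df g l i \<noteq> 0 \<and>
        (df g i j / df g j k) * (df g k l / df g l i) \<noteq> 1 \<and>
        (df g i j / df g j k) * (df g k l / df g l i) = of_real (a i j / a j k)"
      using cr by blast
  qed
  moreover have "\<forall>(i, j) \<in> E. a i j \<noteq> 1"
    using A(2) by (fastforce simp: a_def)
  moreover have "\<forall>(i, j) \<in> E. df g i j \<noteq> 0 \<and> F j = F i ** weierstrass_matrix 1 (a i j) (df g i j)"
  proof clarify
    fix i j assume ij: "(i, j) \<in> E"
    obtain k where su: "su_form k (transition F i j)" using edge_transition[OF F ij] .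
    have "transition F i j = weierstrass_matrix 1 (a i j) (df g i j)"
      using weierstrass_form[OF su A(1,2)[OF ij]] unfolding dg[OF ij] a_def B_def A(1)[OF ij] .
    moreover have "F j = F i ** transition F i j"
      using F ij complex by (auto simp: framing_def framed_def quad_complex_def matrix_mul_assoc adj2_inverse)
    moreover have "df g i j \<noteq> 0" unfolding dg[OF ij] using A(2,3)[OF ij] by simp
    ultimately show "df g i j \<noteq> 0 \<and> F j = F i ** weierstrass_matrix 1 (a i j) (df g i j)" by simp
  qed
  ultimately show ?thesis using F by blast
qed

end

theorem mainTheorem2:
  fixes V :: "'v set" and E :: "('v \<times> 'v) set" and Q :: "('v \<times> 'v \<times> 'v \<times> 'v) set"
    and X N :: "'v \<Rightarrow> complex^2^2"
  assumes "quad_complex V E Q"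
    and "quad_simply_connected V E Q"
    and "discrete_flat_front V E Q X N"
    and "regular_front E X N"
  shows "\<exists>(g :: 'v \<Rightarrow> complex) (a :: 'v \<Rightarrow> 'v \<Rightarrow> real) (t :: real)
          (F :: 'v \<Rightarrow> complex^2^2) (s :: real).
      discrete_holomorphic E Q g a \<and>
      t \<notin> {0} \<union> {1 / a i j | i j. (i, j) \<in> E} \<and>
      (\<forall>i\<in>V. det (F i) = 1) \<and>
      (\<forall>(i, j) \<in> E. df g i j \<noteq> 0 \<and> F j = F i ** weierstrass_matrix t (a i j) (df g i j)) \<and>
      (\<forall>i\<in>V. X i = F i ** (cosh s *\<^sub>R E0 + sinh s *\<^sub>R E3) ** conj_transpose (F i) \<and>
              N i = F i ** (sinh s *\<^sub>R E0 + cosh s *\<^sub>R E3) ** conj_transpose (F i))"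
proof -
  interpret regular_flat_front V E Q X N
    using assms by unfold_locales
  obtain g :: "'v \<Rightarrow> complex" and a F where
    hol: "discrete_holomorphic E Q g a" and a1: "\<forall>(i, j) \<in> E. a i j \<noteq> 1" and F: "framing F"
    and W: "\<forall>(i, j) \<in> E. df g i j \<noteq> 0 \<and> F j = F i ** weierstrass_matrix 1 (a i j) (df g i j)"
    using weierstrass_representation by blast
  have t: "1 \<notin> {0 :: real} \<union> {1 / a i j | i j. (i, j) \<in> E}"
    using a1 by (auto simp: eq_divide_eq)
  have det: "\<forall>i\<in>V. det (F i) = 1"
    and XN: "\<forall>i\<in>V. X i = F i ** (cosh 0 *\<^sub>R E0 + sinh 0 *\<^sub>R E3) ** conj_transpose (F i) \<and>
              N i = F i ** (sinh 0 *\<^sub>R E0 + cosh 0 *\<^sub>R E3) ** conj_transpose (F i)"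
    using F by (simp_all add: framing_def framed_def E0_eq)
  show ?thesis
    using hol t det W XN by blast
qed

end
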